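(* Let $N$ be a Nelson algebra and for $x\in N$ write $\neg x = x\to 0$, where $0=\sim 1$. The following conditions are equivalent (each condition meaning that the stated identity holds for all $x,y,z\in N$): (NT$_3$) $((x\to z)\to y)\to(((y\to x)\to y)\to y)=1$; (FN1) $x\vee\neg y\vee(x\to y)=1$; (FN2) $y=((x\to z)\to y)\wedge((y\to x)\to y)$; (FN3) $y=(\neg x\to y)\wedge((y\to x)\to y)$; (FN4) $((y\to x)\to y)\to((\neg x\to y)\to y)=1$; (FN5) $(\neg x\to y)\to(((y\to x)\to y)\to y)=1$.
   Context: A Nelson algebra is an algebra $(N,1,\sim,\wedge,\vee,\to)$ of type $(0,1,2,2,2)$ satisfying, for all $x,y,z$: $x\wedge(x\vee y)=x$; $x\wedge(y\vee z)=(z\wedge x)\vee(y\wedge x)$; $\sim\sim x=x$; $\sim(x\vee y)=\sim x\vee\sim y$; $x\wedge\sim x=(x\wedge\sim x)\wedge(y\vee\sim y)$; $x\to x=1$; $x\to(y\to z)=(x\wedge y)\to z$; $x\wedge(x\to y)=x\wedge(\sim x\vee y)$. It is a bounded distributive lattice with top $1$ and bottom $0=\sim 1$. *)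

theory Defs
  imports Main
begin

unbundle lattice_syntax

text \<open>
  The operations \<open>\<sqinter>\<close>, \<open>\<squnion>\<close> and \<open>1\<close> are those of the purely syntactic classes; the lattice
  laws are consequences of the axioms below.  The subscript in \<open>\<rightarrow>\<^sub>N\<close> only avoids a clash
  with the function-space arrow of \<open>HOL-Library.FuncSet\<close>.

  The law \<open>de_Morgan\<close> has a meet on its right-hand side.  With a join there, as it is sometimes
  misprinted, \<open>\<sim>\<close> would be an order automorphism and only the one-element algebra would remain.
\<close>

class nelson_algebra = one + inf + sup +
  fixes nelson_neg :: "'a \<Rightarrow> 'a" (\<open>\<sim> _\<close> [80] 80)
    and nelson_imp :: "'a \<Rightarrow> 'a \<Rightarrow> 'a" (infixr \<open>\<rightarrow>\<^sub>N\<close> 60)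
  assumes absorb: "x \<sqinter> (x \<squnion> y) = x"
    and distrib: "x \<sqinter> (y \<squnion> z) = (z \<sqinter> x) \<squnion> (y \<sqinter> x)"
    and neg_neg: "\<sim> \<sim> x = x"
    and de_Morgan: "\<sim> (x \<squnion> y) = \<sim> x \<sqinter> \<sim> y"
    and kleene: "x \<sqinter> \<sim> x = (x \<sqinter> \<sim> x) \<sqinter> (y \<squnion> \<sim> y)"
    and imp_refl: "x \<rightarrow>\<^sub>N x = 1"
    and imp_curry: "x \<rightarrow>\<^sub>N (y \<rightarrow>\<^sub>N z) = (x \<sqinter> y) \<rightarrow>\<^sub>N z"
    and inf_imp: "x \<sqinter> (x \<rightarrow>\<^sub>N y) = x \<sqinter> (\<sim> x \<squnion> y)"

abbreviation nelson_zero :: "'a::nelson_algebra" (\<open>0\<^sub>N\<close>)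
  where "0\<^sub>N \<equiv> \<sim> 1"

abbreviation weak_neg :: "'a::nelson_algebra \<Rightarrow> 'a" (\<open>\<not>\<^sub>N _\<close> [80] 80)
  where "\<not>\<^sub>N x \<equiv> x \<rightarrow>\<^sub>N 0\<^sub>N"

definition all_equivalent :: "bool list \<Rightarrow> bool"
  where "all_equivalent Ps \<longleftrightarrow> (\<forall>P\<in>set Ps. \<forall>Q\<in>set Ps. P \<longleftrightarrow> Q)"

end

theory Submission
  imports Defs
begin

text \<open>
  Besides its lattice order, a Nelson algebra carries the preorder \<open>x \<preceq> y \<longleftrightarrow> x \<rightarrow>\<^sub>N y = 1\<close>.
  For it \<open>\<sqinter>\<close>, \<open>\<squnion>\<close> and \<open>\<rightarrow>\<^sub>N\<close> behave as in a Heyting algebra, and \<open>x \<le> y\<close> holds iff both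
  \<open>x \<preceq> y\<close> and \<open>\<sim> y \<preceq> \<sim> x\<close>. Conditions of the form \<open>t = 1\<close> are therefore intuitionistic
  statements: by cases on \<open>y \<squnion> \<not>\<^sub>N x \<squnion> (y \<rightarrow>\<^sub>N x)\<close>, (FN1) gives (FN5), and conversely (FN5) with
  \<open>x \<squnion> \<not>\<^sub>N y \<squnion> (x \<rightarrow>\<^sub>N y)\<close> substituted for \<open>y\<close> gives (FN1). The equations (FN2) and (FN3) need
  moreover the negated inequality, where \<open>\<sim> (w \<rightarrow>\<^sub>N y)\<close> is \<open>\<preceq>\<close>-equivalent to \<open>w \<sqinter> \<sim> y\<close>.
\<close>

section \<open>Distributive lattice reduct\<close>

definition nelson_le :: "'a::nelson_algebra \<Rightarrow> 'a \<Rightarrow> bool" (infix \<open>\<le>\<^sub>N\<close> 50)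
  where "x \<le>\<^sub>N y \<longleftrightarrow> x \<sqinter> y = x"

definition nelson_entails :: "'a::nelson_algebra \<Rightarrow> 'a \<Rightarrow> bool" (infix \<open>\<preceq>\<close> 50)
  where "x \<preceq> y \<longleftrightarrow> x \<rightarrow>\<^sub>N y = 1"

text \<open>Absorption and the twisted distributive law are Sholander's axioms for distributive
  lattices. At equal arguments they give
  \<open>(x \<sqinter> x) \<squnion> (x \<sqinter> x) = x\<close>; absorption at
  \<open>x \<sqinter> x\<close> and a second distribution then collapse this join to
  \<open>x \<sqinter> x\<close>.\<close>

lemma nelson_inf_idem: "x \<sqinter> x = (x::'a::nelson_algebra)"
proof -
  have x: "(x \<sqinter> x) \<squnion> (x \<sqinter> x) = x"
    using absorb[of x x] distrib[of x x x] by simp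
  have "(x \<sqinter> x) \<sqinter> x = x \<sqinter> x"
    using absorb[of "x \<sqinter> x" "x \<sqinter> x"] by (simp add: x)
  then show ?thesis
    using distrib[of x "x \<sqinter> x" "x \<sqinter> x"] by (simp add: x)
qed

lemma nelson_sup_idem: "x \<squnion> x = (x::'a::nelson_algebra)"
  using distrib[of x x x] absorb[of x x] by (simp add: nelson_inf_idem)

text \<open>The reversed factors on the right of \<open>distrib\<close> swap the arguments once the
  doubled joins collapse.\<close>

lemma nelson_inf_commute: "x \<sqinter> y = y \<sqinter> (x::'a::nelson_algebra)"
  using distrib[of x y y] by (simp add: nelson_sup_idem)

lemma nelson_sup_commute: "x \<squnion> y = y \<squnion> (x::'a::nelson_algebra)"
  by (metis neg_neg de_Morgan nelson_inf_commute)

lemma nelson_sup_absorb: "x \<squnion> (x \<sqinter> y) = (x::'a::nelson_algebra)"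
  by (metis absorb distrib nelson_inf_commute nelson_inf_idem nelson_sup_commute)

lemma nelson_le_iff_sup: "x \<le>\<^sub>N y \<longleftrightarrow> x \<squnion> y = y"
  unfolding nelson_le_def by (metis absorb nelson_inf_commute nelson_sup_absorb nelson_sup_commute)

lemma nelson_inf_sup_distrib: "x \<sqinter> (y \<squnion> z) = (x \<sqinter> y) \<squnion> (x \<sqinter> (z::'a::nelson_algebra))"
  by (metis distrib nelson_inf_commute nelson_sup_commute)

text \<open>Associativity comes for free, since the order-theoretic locale asks only for greatest
  lower and least upper bounds. Transitivity rests on distributivity.\<close>

interpretation nelson: lattice inf "(\<le>\<^sub>N)" "\<lambda>x y::'a::nelson_algebra. x \<le>\<^sub>N y \<and> x \<noteq> y" sup
proof
  fix x y z :: 'a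
  show "x \<le>\<^sub>N y \<and> x \<noteq> y \<longleftrightarrow> x \<le>\<^sub>N y \<and> \<not> y \<le>\<^sub>N x"
    by (metis nelson_le_def nelson_inf_commute nelson_inf_idem)
  show "x \<le>\<^sub>N x"
    by (simp add: nelson_le_def nelson_inf_idem)
  show "x = y" if "x \<le>\<^sub>N y" "y \<le>\<^sub>N x"
    using that by (metis nelson_le_def nelson_inf_commute)
  show "x \<le>\<^sub>N z" if "x \<le>\<^sub>N y" "y \<le>\<^sub>N z"
    using that
    by (metis nelson_le_def nelson_le_iff_sup nelson_inf_sup_distrib nelson_sup_absorb)
  show "x \<sqinter> y \<le>\<^sub>N x"
    by (metis nelson_le_iff_sup nelson_sup_absorb nelson_sup_commute)
  show "x \<sqinter> y \<le>\<^sub>N y"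
    by (metis nelson_le_iff_sup nelson_sup_absorb nelson_sup_commute nelson_inf_commute)
  show "x \<le>\<^sub>N y \<sqinter> z" if "x \<le>\<^sub>N y" "x \<le>\<^sub>N z"
    using that by (metis nelson_le_def nelson_le_iff_sup nelson_inf_sup_distrib nelson_inf_commute)
  show "x \<le>\<^sub>N x \<squnion> y"
    by (simp add: nelson_le_def absorb)
  show "y \<le>\<^sub>N x \<squnion> y"
    by (metis nelson_le_def absorb nelson_sup_commute)
  show "y \<squnion> z \<le>\<^sub>N x" if "y \<le>\<^sub>N x" "z \<le>\<^sub>N x"
    using that by (metis nelson_le_def nelson_inf_sup_distrib nelson_inf_commute)
qed

interpretation nelson: distrib_lattice inf "(\<le>\<^sub>N)" "\<lambda>x y::'a::nelson_algebra. x \<le>\<^sub>N y \<and> x \<noteq> y" sup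
  by standard (rule nelson.distrib_imp1, rule nelson_inf_sup_distrib)

lemmas nelson_order_intros =
  nelson.inf.boundedI nelson.sup.boundedI nelson.inf.coboundedI1 nelson.inf.coboundedI2
  nelson.sup.coboundedI1 nelson.sup.coboundedI2

text \<open>Case analysis inside the lattice: \<open>x\<close> is the join of its parts under
  \<open>y\<close> and under \<open>z\<close>.\<close>

lemma le_sup_inf_cut:
  fixes x y z :: "'a::nelson_algebra"
  assumes "x \<le>\<^sub>N y \<squnion> z" "x \<sqinter> y \<le>\<^sub>N w" "x \<sqinter> z \<le>\<^sub>N w"
  shows "x \<le>\<^sub>N w"
proof -
  have "x = (x \<sqinter> y) \<squnion> (x \<sqinter> z)"
    using assms(1) by (metis nelson_le_def nelson_inf_sup_distrib)
  then show ?thesis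
    using assms(2,3) by (metis nelson.sup.boundedI)
qed

section \<open>De Morgan negation and bounds\<close>

lemma de_Morgan_inf: "\<sim> (x \<sqinter> y) = \<sim> x \<squnion> \<sim> (y::'a::nelson_algebra)"
  by (metis de_Morgan neg_neg)

lemma neg_antimono: "x \<le>\<^sub>N y \<Longrightarrow> \<sim> y \<le>\<^sub>N \<sim> x"
  by (metis de_Morgan nelson_le_def nelson_le_iff_sup nelson_inf_commute)

lemma kleene_le: "x \<sqinter> \<sim> x \<le>\<^sub>N y \<squnion> \<sim> y"
  unfolding nelson_le_def using kleene[of x y] by simp

text \<open>At equal arguments \<open>inf_imp\<close> turns \<open>x \<sqinter> 1\<close> into a
  meet that absorption reduces to \<open>x\<close>.\<close>

lemma le_one: "x \<le>\<^sub>N (1::'a::nelson_algebra)"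
proof -
  have "x \<sqinter> 1 = x \<sqinter> (x \<squnion> \<sim> x)"
    using inf_imp[of x x] by (simp add: imp_refl nelson_sup_commute)
  then show ?thesis
    by (simp add: nelson_le_def absorb)
qed

lemma nelson_zero_le: "0\<^sub>N \<le>\<^sub>N (x::'a::nelson_algebra)"
  using neg_antimono[OF le_one[of "\<sim> x"]] by (simp add: neg_neg)

section \<open>The entailment preorder\<close>

lemma imp_one: "x \<rightarrow>\<^sub>N 1 = (1::'a::nelson_algebra)"
  using imp_curry[of x x x] by (simp add: imp_refl nelson_inf_idem)

text \<open>This pure lattice form of entailment reduces the rules below to lattice calculations
  with the Kleene law.\<close>

lemma entails_iff_le: "x \<preceq> y \<longleftrightarrow> x \<le>\<^sub>N \<sim> x \<squnion> y"
proof
  assume "x \<preceq> y"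
  then show "x \<le>\<^sub>N \<sim> x \<squnion> y"
    using inf_imp[of x y] le_one[of x] by (simp add: nelson_entails_def nelson_le_def)
next
  assume "x \<le>\<^sub>N \<sim> x \<squnion> y"
  then have "x \<sqinter> (x \<rightarrow>\<^sub>N y) = x"
    using inf_imp[of x y] by (simp add: nelson_le_def)
  \<comment> \<open>The outer antecedent \<open>x\<close> equals
    \<open>x \<sqinter> (x \<rightarrow>\<^sub>N y)\<close>, which currying splits in two.\<close>
  then have "x \<rightarrow>\<^sub>N (x \<rightarrow>\<^sub>N y) = x \<rightarrow>\<^sub>N ((x \<rightarrow>\<^sub>N y) \<rightarrow>\<^sub>N (x \<rightarrow>\<^sub>N y))"
    by (simp only: imp_curry[of x "x \<rightarrow>\<^sub>N y"])
  also have "\<dots> = 1"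
    by (simp only: imp_refl imp_one)
  finally have "x \<rightarrow>\<^sub>N (x \<rightarrow>\<^sub>N y) = 1" .
  then show "x \<preceq> y"
    by (simp add: nelson_entails_def imp_curry nelson_inf_idem)
qed

lemma entails_of_le: "x \<le>\<^sub>N y \<Longrightarrow> x \<preceq> y"
  by (simp add: entails_iff_le nelson.sup.coboundedI2)

lemma entails_imp_iff: "x \<preceq> y \<rightarrow>\<^sub>N z \<longleftrightarrow> x \<sqinter> y \<preceq> z"
  by (simp add: nelson_entails_def imp_curry)

text \<open>Contraposition fails for \<open>\<preceq>\<close> in general; this weaker form survives
  by negating the lattice inequality.\<close>

lemma entails_neg_le:
  assumes "x \<preceq> y"
  shows "x \<sqinter> \<sim> y \<le>\<^sub>N \<sim> x"
  using neg_antimono[OF assms[unfolded entails_iff_le]] by (simp add: de_Morgan neg_neg)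

lemma entails_trans [trans]:
  assumes "x \<preceq> y" "y \<preceq> z"
  shows "x \<preceq> z"
proof -
  \<comment> \<open>First the part of \<open>x\<close> under \<open>y\<close>, split along
    \<open>\<sim> y\<close> and \<open>z\<close>; the part under \<open>\<sim> x\<close> is
    immediate.\<close>
  have "x \<sqinter> y \<le>\<^sub>N \<sim> x \<squnion> z"
  proof (rule le_sup_inf_cut)
    show "x \<sqinter> y \<le>\<^sub>N \<sim> y \<squnion> z"
      using assms(2) by (simp add: entails_iff_le nelson.inf.coboundedI2)
    have "(x \<sqinter> y) \<sqinter> \<sim> y \<le>\<^sub>N x \<sqinter> \<sim> y"
      by (intro nelson.inf_mono nelson.inf_le1 nelson.order_refl)
    then show "(x \<sqinter> y) \<sqinter> \<sim> y \<le>\<^sub>N \<sim> x \<squnion> z"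
      using entails_neg_le[OF assms(1)] by (meson nelson.order_trans nelson.sup_ge1)
  qed (simp add: nelson_order_intros)
  then have "x \<le>\<^sub>N \<sim> x \<squnion> z"
    by (rule le_sup_inf_cut[OF assms(1)[unfolded entails_iff_le], rotated])
      (simp add: nelson_order_intros)
  then show ?thesis
    by (simp add: entails_iff_le)
qed

lemma entails_inf: "x \<preceq> y \<Longrightarrow> x \<preceq> z \<Longrightarrow> x \<preceq> y \<sqinter> z"
  by (simp add: entails_iff_le nelson.sup_inf_distrib1)

text \<open>Distributing over \<open>\<sim> x \<sqinter> \<sim> y\<close> leaves mixed cases such as
  \<open>x \<sqinter> \<sim> x\<close> under \<open>\<sim> y \<squnion> z\<close>, which the Kleene
  law settles.\<close>

lemma entails_sup_left:
  assumes "x \<preceq> z" "y \<preceq> z"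
  shows "x \<squnion> y \<preceq> z"
proof -
  have half: "u \<le>\<^sub>N (\<sim> u \<sqinter> \<sim> v) \<squnion> z" if "u \<preceq> z" "v \<preceq> z" for u v
  proof (rule le_sup_inf_cut)
    show "u \<le>\<^sub>N \<sim> u \<squnion> z"
      using that(1) by (simp add: entails_iff_le)
    have "v \<squnion> \<sim> v \<le>\<^sub>N \<sim> v \<squnion> z"
      using that(2) by (simp add: entails_iff_le)
    then have "u \<sqinter> \<sim> u \<le>\<^sub>N \<sim> v \<squnion> z"
      using kleene_le nelson.order_trans by blast
    then show "u \<sqinter> \<sim> u \<le>\<^sub>N (\<sim> u \<sqinter> \<sim> v) \<squnion> z"
      by (simp add: nelson.sup_inf_distrib2 nelson_order_intros)
  qed (simp add: nelson_order_intros)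
  show ?thesis
    using half[OF assms] half[OF assms(2,1)]
    by (simp add: entails_iff_le de_Morgan nelson_inf_commute)
qed

lemma one_entails_iff: "1 \<preceq> x \<longleftrightarrow> x = (1::'a::nelson_algebra)"
proof
  assume "1 \<preceq> x"
  then have "1 \<le>\<^sub>N x"
    using nelson_zero_le[of x] by (simp add: entails_iff_le nelson_le_iff_sup)
  then show "x = 1"
    using le_one by (blast intro: nelson.order_antisym)
qed (simp add: nelson_entails_def imp_refl)

text \<open>The first entailment leaves only \<open>x \<sqinter> \<sim> x\<close> to bound; by the
  Kleene law it splits along \<open>y\<close> and \<open>\<sim> y\<close>, and the second entailment
  handles \<open>\<sim> y\<close>.\<close>

lemma le_of_entails:
  assumes "x \<preceq> y" "\<sim> y \<preceq> \<sim> x"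
  shows "x \<le>\<^sub>N y"
proof (rule le_sup_inf_cut)
  show "x \<le>\<^sub>N \<sim> x \<squnion> y"
    using assms(1) by (simp add: entails_iff_le)
  have *: "\<sim> y \<sqinter> x \<le>\<^sub>N y"
    using entails_neg_le[OF assms(2)] by (simp add: neg_neg)
  show "x \<sqinter> \<sim> x \<le>\<^sub>N y"
  proof (rule le_sup_inf_cut[OF kleene_le[of x y]])
    have "(x \<sqinter> \<sim> x) \<sqinter> \<sim> y \<le>\<^sub>N \<sim> y \<sqinter> x"
      by (simp add: nelson_order_intros)
    then show "(x \<sqinter> \<sim> x) \<sqinter> \<sim> y \<le>\<^sub>N y"
      using * nelson.order_trans by blast
  qed simp
qed simp

lemma contradiction_entails: "x \<sqinter> \<sim> x \<preceq> y"
  by (simp add: entails_iff_le de_Morgan_inf neg_neg nelson_order_intros)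

text \<open>Negating \<open>inf_imp\<close> gives this up to a summand \<open>\<sim> x\<close>,
  which entailment tolerates because \<open>\<sim> x\<close> lies below
  \<open>\<sim> (x \<sqinter> \<sim> y)\<close>.\<close>

lemma inf_neg_entails_neg_imp: "x \<sqinter> \<sim> y \<preceq> \<sim> (x \<rightarrow>\<^sub>N y)"
proof -
  have "\<sim> x \<squnion> \<sim> (x \<rightarrow>\<^sub>N y) = \<sim> x \<squnion> (x \<sqinter> \<sim> y)"
    using arg_cong[OF inf_imp[of x y], of nelson_neg] by (simp add: de_Morgan_inf de_Morgan neg_neg)
  then have "x \<sqinter> \<sim> y \<le>\<^sub>N \<sim> x \<squnion> \<sim> (x \<rightarrow>\<^sub>N y)"
    by simp
  then show ?thesis
    by (simp add: entails_iff_le de_Morgan_inf neg_neg nelson.sup_assoc nelson.sup_left_commute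
        nelson.sup.coboundedI2)
qed

text \<open>Weakening is needed in the lattice order, so the negated entailment must hold too. Its
  hard case is \<open>\<sim> x\<close>: there \<open>?u\<close> follows from a contradiction, up to
  \<open>x \<sqinter> \<sim> x\<close>, which the Kleene law bounds.\<close>

lemma le_imp: "y \<le>\<^sub>N x \<rightarrow>\<^sub>N y"
proof (rule le_of_entails)
  let ?u = "x \<rightarrow>\<^sub>N y"
  show y: "y \<preceq> ?u"
    by (simp add: entails_imp_iff entails_of_le)
  have "\<sim> x \<preceq> ?u"
    using contradiction_entails[of x y] by (simp add: entails_imp_iff nelson_inf_commute)
  then have nx: "\<sim> x \<le>\<^sub>N x \<squnion> ?u"
    by (simp add: entails_iff_le neg_neg)
  have "x \<sqinter> (\<sim> x \<squnion> y) \<le>\<^sub>N ?u"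
    using inf_imp[of x y] by (metis nelson.inf_le2)
  then have "\<sim> ?u \<le>\<^sub>N \<sim> x \<squnion> (x \<sqinter> \<sim> y)"
    using neg_antimono by (fastforce simp: de_Morgan_inf de_Morgan neg_neg)
  then have "\<sim> ?u \<le>\<^sub>N ?u \<squnion> \<sim> y"
  proof (rule le_sup_inf_cut)
    show "\<sim> ?u \<sqinter> \<sim> x \<le>\<^sub>N ?u \<squnion> \<sim> y"
    proof (rule le_sup_inf_cut)
      show "\<sim> ?u \<sqinter> \<sim> x \<le>\<^sub>N x \<squnion> ?u"
        using nx by (rule nelson.inf.coboundedI2)
      have "(\<sim> ?u \<sqinter> \<sim> x) \<sqinter> x \<le>\<^sub>N x \<sqinter> \<sim> x"
        by (simp add: nelson_order_intros)
      also have "\<dots> \<le>\<^sub>N y \<squnion> \<sim> y"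
        by (rule kleene_le)
      also have "\<dots> \<le>\<^sub>N ?u \<squnion> \<sim> y"
        using y by (simp add: entails_iff_le nelson_sup_commute)
      finally show "(\<sim> ?u \<sqinter> \<sim> x) \<sqinter> x \<le>\<^sub>N ?u \<squnion> \<sim> y" .
    qed (simp add: nelson_order_intros)
  qed (simp add: nelson_order_intros)
  then show "\<sim> ?u \<preceq> \<sim> y"
    by (simp add: entails_iff_le neg_neg)
qed

section \<open>Deduction rules for entailment\<close>

lemma imp_mp: "z \<preceq> x \<rightarrow>\<^sub>N y \<Longrightarrow> z \<preceq> x \<Longrightarrow> z \<preceq> y"
  by (meson entails_imp_iff entails_inf entails_of_le entails_trans nelson.order_refl)

lemma entails_inf_sup_cases:
  fixes x y z :: "'a::nelson_algebra"
  assumes "y \<squnion> z = 1" "x \<sqinter> y \<preceq> w" "x \<sqinter> z \<preceq> w"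
  shows "x \<preceq> w"
proof -
  have "x = (x \<sqinter> y) \<squnion> (x \<sqinter> z)"
    using assms(1) le_one[of x] by (metis nelson_le_def nelson_inf_sup_distrib)
  then show ?thesis
    using assms(2,3) by (metis entails_sup_left)
qed

lemma imp_mono_right: "y \<preceq> z \<Longrightarrow> x \<rightarrow>\<^sub>N y \<preceq> x \<rightarrow>\<^sub>N z"
  by (meson entails_imp_iff entails_trans entails_of_le nelson.order_refl)

section \<open>Implications between the identities\<close>

lemma FN1_imp_FN2:
  fixes x y z :: "'a::nelson_algebra"
  assumes "y \<squnion> \<not>\<^sub>N x \<squnion> (y \<rightarrow>\<^sub>N x) = 1"
  shows "y = ((x \<rightarrow>\<^sub>N z) \<rightarrow>\<^sub>N y) \<sqinter> ((y \<rightarrow>\<^sub>N x) \<rightarrow>\<^sub>N y)"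
proof (rule nelson.order_antisym)
  let ?p = "x \<rightarrow>\<^sub>N z" and ?q = "y \<rightarrow>\<^sub>N x"
  let ?r = "(?p \<rightarrow>\<^sub>N y) \<sqinter> (?q \<rightarrow>\<^sub>N y)"
  \<comment> \<open>As \<open>0\<^sub>N\<close> lies below \<open>z\<close>, the case
    \<open>\<not>\<^sub>N x\<close> of the hypothesis is subsumed by the case
    \<open>?p\<close>.\<close>
  have "\<not>\<^sub>N x \<preceq> ?p"
    by (simp add: imp_mono_right entails_of_le nelson_zero_le)
  have cases: "u \<preceq> w" if "u \<sqinter> y \<preceq> w" "u \<sqinter> ?p \<preceq> w" "u \<sqinter> ?q \<preceq> w" for u w
  proof -
    have "u \<sqinter> \<not>\<^sub>N x \<preceq> u \<sqinter> ?p"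
      using \<open>\<not>\<^sub>N x \<preceq> ?p\<close> by (meson entails_inf entails_of_le entails_trans nelson.inf_le1 nelson.inf_le2)
    then have "u \<sqinter> \<not>\<^sub>N x \<preceq> w"
      using that(2) by (rule entails_trans)
    with that(1) have "u \<sqinter> (y \<squnion> \<not>\<^sub>N x) \<preceq> w"
      by (simp add: nelson_inf_sup_distrib entails_sup_left)
    then show ?thesis
      using assms that(3) entails_inf_sup_cases by blast
  qed
  show "y \<le>\<^sub>N ?r"
    by (intro nelson.inf.boundedI le_imp)
  show "?r \<le>\<^sub>N y"
  proof (rule le_of_entails)
    show "?r \<preceq> y"
    proof (rule cases)
      show "?r \<sqinter> ?p \<preceq> y"
        by (rule imp_mp[of _ ?p]) (simp_all add: entails_of_le nelson_order_intros)
      show "?r \<sqinter> ?q \<preceq> y"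
        by (rule imp_mp[of _ ?q]) (simp_all add: entails_of_le nelson_order_intros)
    qed (simp add: entails_of_le)
    show "\<sim> y \<preceq> \<sim> ?r"
    proof (rule cases)
      show "\<sim> y \<sqinter> y \<preceq> \<sim> ?r"
        using contradiction_entails by (simp add: nelson_inf_commute)
      \<comment> \<open>For \<open>w\<close> equal to \<open>?p\<close> or \<open>?q\<close>,
        \<open>?r\<close> lies below \<open>w \<rightarrow>\<^sub>N y\<close>, so the premise holds
        by antitonicity.\<close>
      have *: "\<sim> y \<sqinter> w \<preceq> \<sim> ?r" if "\<sim> (w \<rightarrow>\<^sub>N y) \<le>\<^sub>N \<sim> ?r" for w
        using inf_neg_entails_neg_imp[of w y] entails_of_le[OF that] entails_trans
        by (simp add: nelson_inf_commute) blast
      show "\<sim> y \<sqinter> ?p \<preceq> \<sim> ?r" "\<sim> y \<sqinter> ?q \<preceq> \<sim> ?r"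
        by (simp_all add: * neg_antimono)
    qed
  qed
qed

text \<open>Taking the whole join \<open>?d\<close> for \<open>y\<close> in (FN5) makes both
  antecedents equal to \<open>1\<close>, which forces \<open>?d = 1\<close>.\<close>

lemma FN5_imp_FN1:
  fixes x y :: "'a::nelson_algebra"
  assumes FN5: "\<And>x y :: 'a. (\<not>\<^sub>N x \<rightarrow>\<^sub>N y) \<rightarrow>\<^sub>N (((y \<rightarrow>\<^sub>N x) \<rightarrow>\<^sub>N y) \<rightarrow>\<^sub>N y) = 1"
  shows "x \<squnion> \<not>\<^sub>N y \<squnion> (x \<rightarrow>\<^sub>N y) = 1"
proof -
  let ?d = "x \<squnion> \<not>\<^sub>N y \<squnion> (x \<rightarrow>\<^sub>N y)"
  have "\<not>\<^sub>N y \<preceq> ?d"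
    by (simp add: entails_of_le nelson_order_intros)
  then have 1: "1 \<preceq> \<not>\<^sub>N y \<rightarrow>\<^sub>N ?d"
    by (simp only: one_entails_iff flip: nelson_entails_def)
  \<comment> \<open>Here \<open>x\<close> lies below \<open>?d\<close>, and
    \<open>x \<rightarrow>\<^sub>N y\<close> is itself a joinand of \<open>?d\<close>.\<close>
  have "?d \<rightarrow>\<^sub>N y \<preceq> x \<rightarrow>\<^sub>N y"
    unfolding entails_imp_iff
    by (rule imp_mp[of _ ?d]) (simp_all add: entails_of_le nelson_order_intros)
  also have "x \<rightarrow>\<^sub>N y \<preceq> ?d"
    by (simp add: entails_of_le)
  finally have 2: "1 \<preceq> (?d \<rightarrow>\<^sub>N y) \<rightarrow>\<^sub>N ?d"
    by (simp only: one_entails_iff flip: nelson_entails_def)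
  have "1 \<preceq> (\<not>\<^sub>N y \<rightarrow>\<^sub>N ?d) \<rightarrow>\<^sub>N (((?d \<rightarrow>\<^sub>N y) \<rightarrow>\<^sub>N ?d) \<rightarrow>\<^sub>N ?d)"
    using FN5[of y ?d] by (simp add: one_entails_iff)
  then have "1 \<preceq> ?d"
    using 1 2 imp_mp by blast
  then show ?thesis
    by (simp add: one_entails_iff)
qed

lemma imp_imp_eq_one_of_eq_inf: "y = u \<sqinter> v \<Longrightarrow> u \<rightarrow>\<^sub>N (v \<rightarrow>\<^sub>N y) = (1::'a::nelson_algebra)"
  by (simp add: imp_curry imp_refl)

text \<open>Exchange is what separates (FN4) from (FN5), which differ only in the order of two
  antecedents.\<close>

lemma imp_swap: "x \<rightarrow>\<^sub>N (y \<rightarrow>\<^sub>N z) = y \<rightarrow>\<^sub>N (x \<rightarrow>\<^sub>N (z::'a::nelson_algebra))"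
  by (simp add: imp_curry nelson_inf_commute)

theorem theorem2p7:
  shows "all_equivalent
    [\<forall>x y z :: 'a::nelson_algebra.
       ((x \<rightarrow>\<^sub>N z) \<rightarrow>\<^sub>N y) \<rightarrow>\<^sub>N (((y \<rightarrow>\<^sub>N x) \<rightarrow>\<^sub>N y) \<rightarrow>\<^sub>N y) = 1,
     \<forall>x y :: 'a. x \<squnion> \<not>\<^sub>N y \<squnion> (x \<rightarrow>\<^sub>N y) = 1,
     \<forall>x y z :: 'a. y = ((x \<rightarrow>\<^sub>N z) \<rightarrow>\<^sub>N y) \<sqinter> ((y \<rightarrow>\<^sub>N x) \<rightarrow>\<^sub>N y),
     \<forall>x y :: 'a. y = (\<not>\<^sub>N x \<rightarrow>\<^sub>N y) \<sqinter> ((y \<rightarrow>\<^sub>N x) \<rightarrow>\<^sub>N y),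
     \<forall>x y :: 'a. ((y \<rightarrow>\<^sub>N x) \<rightarrow>\<^sub>N y) \<rightarrow>\<^sub>N ((\<not>\<^sub>N x \<rightarrow>\<^sub>N y) \<rightarrow>\<^sub>N y) = 1,
     \<forall>x y :: 'a. (\<not>\<^sub>N x \<rightarrow>\<^sub>N y) \<rightarrow>\<^sub>N (((y \<rightarrow>\<^sub>N x) \<rightarrow>\<^sub>N y) \<rightarrow>\<^sub>N y) = 1]"
proof -
  let ?NT3 = "\<forall>x y z :: 'a. ((x \<rightarrow>\<^sub>N z) \<rightarrow>\<^sub>N y) \<rightarrow>\<^sub>N (((y \<rightarrow>\<^sub>N x) \<rightarrow>\<^sub>N y) \<rightarrow>\<^sub>N y) = 1"
  let ?FN1 = "\<forall>x y :: 'a. x \<squnion> \<not>\<^sub>N y \<squnion> (x \<rightarrow>\<^sub>N y) = 1"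
  let ?FN2 = "\<forall>x y z :: 'a. y = ((x \<rightarrow>\<^sub>N z) \<rightarrow>\<^sub>N y) \<sqinter> ((y \<rightarrow>\<^sub>N x) \<rightarrow>\<^sub>N y)"
  let ?FN3 = "\<forall>x y :: 'a. y = (\<not>\<^sub>N x \<rightarrow>\<^sub>N y) \<sqinter> ((y \<rightarrow>\<^sub>N x) \<rightarrow>\<^sub>N y)"
  let ?FN4 = "\<forall>x y :: 'a. ((y \<rightarrow>\<^sub>N x) \<rightarrow>\<^sub>N y) \<rightarrow>\<^sub>N ((\<not>\<^sub>N x \<rightarrow>\<^sub>N y) \<rightarrow>\<^sub>N y) = 1"
  let ?FN5 = "\<forall>x y :: 'a. (\<not>\<^sub>N x \<rightarrow>\<^sub>N y) \<rightarrow>\<^sub>N (((y \<rightarrow>\<^sub>N x) \<rightarrow>\<^sub>N y) \<rightarrow>\<^sub>N y) = 1"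
  have "?FN2" if "?FN1"
    using that by (intro allI FN1_imp_FN2) blast
  moreover have "?NT3" if "?FN2"
    using that by (intro allI imp_imp_eq_one_of_eq_inf) blast
  \<comment> \<open>The instance \<open>z = 0\<^sub>N\<close> turns
    \<open>x \<rightarrow>\<^sub>N z\<close> into \<open>\<not>\<^sub>N x\<close>; the same instance
    leads from \<open>?NT3\<close> to \<open>?FN5\<close>.\<close>
  moreover have "?FN3" if "?FN2"
    using that by blast
  moreover have "?FN5" if "?FN3"
    using that by (intro allI imp_imp_eq_one_of_eq_inf) blast
  moreover have "?FN5" if "?NT3"
    using that by blast
  moreover have "?FN1" if "?FN5"
    using that by (intro allI FN5_imp_FN1) blast
  moreover have "?FN4 \<longleftrightarrow> ?FN5"
    by (subst imp_swap) (rule refl)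
  \<comment> \<open>Two cycles share \<open>?FN1\<close>, \<open>?FN2\<close> and
    \<open>?FN5\<close>: one returns through \<open>?NT3\<close>, the other through
    \<open>?FN3\<close>.\<close>
  ultimately have "?NT3 \<longleftrightarrow> ?FN5" "?FN1 \<longleftrightarrow> ?FN5" "?FN2 \<longleftrightarrow> ?FN5" "?FN3 \<longleftrightarrow> ?FN5" "?FN4 \<longleftrightarrow> ?FN5"
    by argo+
  then show ?thesis
    unfolding all_equivalent_def by simp
qed

end
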